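(* Let $\mathcal{X}$ and $\mathcal{A}$ be finite sets, $K$ a positive integer, $x_1\in\mathcal{X}$ given, $\{\xi_k\}_{k=1}^{K-1}$ an i.i.d. random sequence, $h$ a state-transition function with $h(x,a,\xi)\in\mathcal{X}$, $r:\mathcal{X}\times\mathcal{A}\to\mathbb{R}_+$ an immediate reward function, and for $k=1,\dots,K$ let $W_{k+1}$ be a real-valued function on $\mathcal{X}\times\mathcal{A}$ (an approximation of the expected value-to-go), with $W_{K+1}\equiv0$. Let $(\hat\pi_1,\dots,\hat\pi_K)$ be an approximate dynamic programming (ADP) scheme, i.e. with $\hat x_1=x_1$, for each $k=1,\dots,K$, $$\hat\pi_k(\hat x_k)\in\operatorname*{argmax}_{a\in\mathcal{A}}\{r(\hat x_k,a)+W_{k+1}(\hat x_k,a)\},\qquad \hat x_{k+1}=h(\hat x_k,\hat\pi_k(\hat x_k),\xi_k)\ \ (k\le K-1).$$ Define the surrogate objective $\tilde g$, for $k=1,\dots,K$, $x_1,\dots,x_k\in\mathcal{X}$ and $a_1,\dots,a_k\in\mathcal{A}$, by $$\tilde g(x_1,\dots,x_k;a_1,\dots,a_k)=\sum_{i=1}^k r(x_i,a_i)+W_{k+1}(x_k,a_k),$$ assumed to take values in $\mathbb{R}_+$. Then the ADP scheme $(\hat\pi_1,\dots,\hat\pi_K)$ is a path-dependent action optimization (PDAO) scheme for the problem of maximizing $\mathrm{E}[\tilde g(x_1,\dots,x_K;\pi_1(x_1),\dots,\pi_K(x_K))\mid x_1]$ over policies $(\pi_1,\dots,\pi_K)$ subject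 to $x_{k+1}=h(x_k,\pi_k(x_k),\xi_k)$, $k=1,\dots,K-1$.
   Context: Policy: a policy $\pi_k$ at time $k$ is a (randomized) mapping assigning to each state in $\mathcal{X}$ an action in $\mathcal{A}$, where the chosen action is a random variable measurable with respect to $\xi_1,\dots,\xi_{k-1}$. $\mathrm{E}[\cdot\mid x_1]$ is expectation given the initial state. PDAO scheme: given $x_1^p=x_1$, the policy $(\pi_1^p,\dots,\pi_K^p)$ is a PDAO scheme for the objective $\tilde g$ if for every $k=1,\dots,K$ (along every sample path $\xi_1,\dots,\xi_{k-1}$) $$\pi_k^p(x_k^p)\in\operatorname*{argmax}_{a\in\mathcal{A}}\ \tilde g(x_1^p,\dots,x_k^p;\pi_1^p(x_1^p),\dots,\pi_{k-1}^p(x_{k-1}^p),a),$$ where $x_{i+1}^p=h(x_i^p,\pi_i^p(x_i^p),\xi_i)$ for $1\le i\le k-1$. *)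

theory Defs
  imports "HOL-Probability.Probability"
begin

text \<open>
  Time runs from \<open>1\<close> to \<open>K\<close>. A policy is a family \<open>\<pi> k x \<omega>\<close>: the action chosen at time \<open>k\<close> in
  state \<open>x\<close> on the sample point \<open>\<omega>\<close>. The noise \<open>\<xi> i\<close> takes values in the measurable space \<open>N\<close>.
\<close>

text \<open>
  The sigma-algebra generated by the random vector \<open>(\<xi> 1, \<dots>, \<xi> (k - 1))\<close>. For \<open>k = 1\<close> it is the
  trivial one, so the first action is deterministic.
\<close>
definition noise_history ::
  "'w measure \<Rightarrow> 's measure \<Rightarrow> (nat \<Rightarrow> 'w \<Rightarrow> 's) \<Rightarrow> nat \<Rightarrow> 'w measure"
where
  "noise_history M N \<xi> k =
     vimage_algebra (space M) (\<lambda>\<omega>. \<lambda>i\<in>{1..<k}. \<xi> i \<omega>) (Pi\<^sub>M {1..<k} (\<lambda>_. N))"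

definition is_policy ::
  "'w measure \<Rightarrow> 's measure \<Rightarrow> (nat \<Rightarrow> 'w \<Rightarrow> 's) \<Rightarrow> 'x set \<Rightarrow> 'a set \<Rightarrow> nat
    \<Rightarrow> (nat \<Rightarrow> 'x \<Rightarrow> 'w \<Rightarrow> 'a) \<Rightarrow> bool"
where
  "is_policy M N \<xi> X A K \<pi> \<longleftrightarrow>
     (\<forall>k\<in>{1..K}. \<forall>x\<in>X. \<pi> k x \<in> noise_history M N \<xi> k \<rightarrow>\<^sub>M count_space A)"

text \<open>The state at time \<open>k \<ge> 1\<close>; the value at index \<open>0\<close> is a dummy.\<close>
primrec state ::
  "('x \<Rightarrow> 'a \<Rightarrow> 's \<Rightarrow> 'x) \<Rightarrow> (nat \<Rightarrow> 'w \<Rightarrow> 's) \<Rightarrow> 'x \<Rightarrow> (nat \<Rightarrow> 'x \<Rightarrow> 'w \<Rightarrow> 'a)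
    \<Rightarrow> nat \<Rightarrow> 'w \<Rightarrow> 'x"
where
  "state h \<xi> x1 \<pi> 0 \<omega> = x1"
| "state h \<xi> x1 \<pi> (Suc k) \<omega> =
     (if k = 0 then x1
      else h (state h \<xi> x1 \<pi> k \<omega>) (\<pi> k (state h \<xi> x1 \<pi> k \<omega>) \<omega>) (\<xi> k \<omega>))"

definition action ::
  "('x \<Rightarrow> 'a \<Rightarrow> 's \<Rightarrow> 'x) \<Rightarrow> (nat \<Rightarrow> 'w \<Rightarrow> 's) \<Rightarrow> 'x \<Rightarrow> (nat \<Rightarrow> 'x \<Rightarrow> 'w \<Rightarrow> 'a)
    \<Rightarrow> nat \<Rightarrow> 'w \<Rightarrow> 'a"
where
  "action h \<xi> x1 \<pi> k \<omega> = \<pi> k (state h \<xi> x1 \<pi> k \<omega>) \<omega>"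

text \<open>
  Path-dependent action optimization for the problem of maximizing, over all policies, the
  expectation of \<open>g [x\<^sub>1, \<dots>, x\<^sub>K] [a\<^sub>1, \<dots>, a\<^sub>K]\<close> given \<open>x\<^sub>1\<close>, where \<open>x\<^sub>k\<close> and \<open>a\<^sub>k\<close> are the states and
  actions under the policy. A path-dependent objective is defined on all paths of length at most
  \<open>K\<close>, and the scheme uses it pointwise on the partial paths, so no expectation enters.
\<close>
definition PDAO_scheme ::
  "'w measure \<Rightarrow> 's measure \<Rightarrow> (nat \<Rightarrow> 'w \<Rightarrow> 's) \<Rightarrow> 'x set \<Rightarrow> 'a set \<Rightarrow> nat
    \<Rightarrow> ('x \<Rightarrow> 'a \<Rightarrow> 's \<Rightarrow> 'x) \<Rightarrow> 'x \<Rightarrow> ('x list \<Rightarrow> 'a list \<Rightarrow> real)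
    \<Rightarrow> (nat \<Rightarrow> 'x \<Rightarrow> 'w \<Rightarrow> 'a) \<Rightarrow> bool"
where
  "PDAO_scheme M N \<xi> X A K h x1 g \<pi> \<longleftrightarrow>
     is_policy M N \<xi> X A K \<pi> \<and>
     (\<forall>k\<in>{1..K}. \<forall>\<omega>\<in>space M.
        is_arg_max
          (\<lambda>a. g (map (\<lambda>i. state h \<xi> x1 \<pi> i \<omega>) [1..<Suc k])
                 (map (\<lambda>i. action h \<xi> x1 \<pi> i \<omega>) [1..<k] @ [a]))
          (\<lambda>a. a \<in> A)
          (action h \<xi> x1 \<pi> k \<omega>))"

definition ADP_scheme ::
  "'w measure \<Rightarrow> 's measure \<Rightarrow> (nat \<Rightarrow> 'w \<Rightarrow> 's) \<Rightarrow> 'x set \<Rightarrow> 'a set \<Rightarrow> nat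
    \<Rightarrow> ('x \<Rightarrow> 'a \<Rightarrow> 's \<Rightarrow> 'x) \<Rightarrow> 'x \<Rightarrow> ('x \<Rightarrow> 'a \<Rightarrow> real) \<Rightarrow> (nat \<Rightarrow> 'x \<Rightarrow> 'a \<Rightarrow> real)
    \<Rightarrow> (nat \<Rightarrow> 'x \<Rightarrow> 'w \<Rightarrow> 'a) \<Rightarrow> bool"
where
  "ADP_scheme M N \<xi> X A K h x1 r W \<pi> \<longleftrightarrow>
     is_policy M N \<xi> X A K \<pi> \<and>
     (\<forall>k\<in>{1..K}. \<forall>\<omega>\<in>space M.
        is_arg_max
          (\<lambda>a. r (state h \<xi> x1 \<pi> k \<omega>) a + W (k + 1) (state h \<xi> x1 \<pi> k \<omega>) a)
          (\<lambda>a. a \<in> A)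
          (action h \<xi> x1 \<pi> k \<omega>))"

text \<open>
  Meant for nonempty lists of equal length \<open>k\<close>. Lists are indexed from \<open>0\<close>, so \<open>xs ! i\<close> is the
  state at time \<open>i + 1\<close>.
\<close>
definition surrogate ::
  "('x \<Rightarrow> 'a \<Rightarrow> real) \<Rightarrow> (nat \<Rightarrow> 'x \<Rightarrow> 'a \<Rightarrow> real) \<Rightarrow> 'x list \<Rightarrow> 'a list \<Rightarrow> real"
where
  "surrogate r W xs as =
     (\<Sum>i<length xs. r (xs ! i) (as ! i)) + W (length xs + 1) (last xs) (last as)"

end

theory Submission
  imports Defs
begin

text \<open>
  When action \<open>k\<close> is chosen, the rewards of the earlier periods are already fixed, so the surrogate
  objective and the ADP objective differ by a constant and have the same maximizers.
\<close>

text \<open>Only the last reward and the \<open>W\<close> term involve \<open>a\<close>. Equal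
  lengths make both lists split at the same index. The extended list has one entry more than
  \<open>xs\<close>, and \<open>surrogate\<close> adds another one, hence
  \<open>length xs + 2\<close>.\<close>

lemma surrogate_snoc:
  assumes "length xs = length as"
  shows "surrogate r W (xs @ [x]) (as @ [a]) =
    (\<Sum>i<length xs. r (xs ! i) (as ! i)) + (r x a + W (length xs + 2) x a)"
  using assms by (simp add: surrogate_def nth_append)

text \<open>Maximality is a strict comparison of values, which translation preserves in an ordered
  group.\<close>

lemma is_arg_max_add_const:
  fixes f :: "'a \<Rightarrow> 'b::ordered_ab_group_add"
  shows "is_arg_max (\<lambda>a. c + f a) P = is_arg_max f P"
  by (simp add: is_arg_max_def fun_eq_iff)

theorem proposition1:
  fixes M :: "'w measure" and N :: "'s measure" and \<xi> :: "nat \<Rightarrow> 'w \<Rightarrow> 's"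
    and X :: "'x set" and A :: "'a set" and K :: nat and x1 :: 'x
    and h :: "'x \<Rightarrow> 'a \<Rightarrow> 's \<Rightarrow> 'x" and r :: "'x \<Rightarrow> 'a \<Rightarrow> real"
    and W :: "nat \<Rightarrow> 'x \<Rightarrow> 'a \<Rightarrow> real" and \<pi> :: "nat \<Rightarrow> 'x \<Rightarrow> 'w \<Rightarrow> 'a"
  assumes "finite X" and "finite A" and "K > 0" and "x1 \<in> X"
    and "prob_space M"
    and "prob_space.indep_vars M (\<lambda>_. N) \<xi> {1..<K}"
    and "\<forall>i\<in>{1..<K}. \<forall>j\<in>{1..<K}. distr M N (\<xi> i) = distr M N (\<xi> j)"
    and "\<forall>x\<in>X. \<forall>a\<in>A. \<forall>s\<in>space N. h x a s \<in> X"
    and "\<forall>x\<in>X. \<forall>a\<in>A. r x a \<ge> 0"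
    and "\<forall>x\<in>X. \<forall>a\<in>A. W (K + 1) x a = 0"
    and "\<forall>k\<in>{1..K}. \<forall>xs as. length xs = k \<and> length as = k \<and> set xs \<subseteq> X \<and> set as \<subseteq> A
           \<longrightarrow> surrogate r W xs as \<ge> 0"
    and "ADP_scheme M N \<xi> X A K h x1 r W \<pi>"
  shows "PDAO_scheme M N \<xi> X A K h x1 (surrogate r W) \<pi>"
proof -
  have "is_arg_max
      (\<lambda>a. surrogate r W (map (\<lambda>i. state h \<xi> x1 \<pi> i \<omega>) [1..<Suc k])
             (map (\<lambda>i. action h \<xi> x1 \<pi> i \<omega>) [1..<k] @ [a]))
      (\<lambda>a. a \<in> A) (action h \<xi> x1 \<pi> k \<omega>)"
    if "k \<in> {1..K}" and "\<omega> \<in> space M" for k \<omega>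
  proof -
    let ?x = "\<lambda>i. state h \<xi> x1 \<pi> i \<omega>"
    let ?as = "map (\<lambda>i. action h \<xi> x1 \<pi> i \<omega>) [1..<k]"
    \<comment> \<open>Both facts rest on \<open>k \<ge> 1\<close>: for \<open>k = 0\<close> the
      range \<open>[1..<Suc k]\<close> is empty, and \<open>length [1..<k]\<close> is the truncated
      \<open>k - 1\<close>.\<close>
    have "map ?x [1..<Suc k] = map ?x [1..<k] @ [?x k]" and "length [1..<k] + 2 = k + 1"
      using that(1) by auto
    then have "surrogate r W (map ?x [1..<Suc k]) (?as @ [a]) =
        (\<Sum>i<length [1..<k]. r (map ?x [1..<k] ! i) (?as ! i)) + (r (?x k) a + W (k + 1) (?x k) a)"
      for a
      by (simp only: surrogate_snoc length_map)
    \<comment> \<open>The sum over the earlier periods is free of \<open>a\<close>, so it acts as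
      the constant \<open>c\<close>. What remains is the ADP objective at the same state
      \<open>?x k\<close>, on the same sample point.\<close>
    then show ?thesis
      using assms(12) that by (simp only: is_arg_max_add_const ADP_scheme_def)
  qed
  then show ?thesis
    using assms(12) unfolding PDAO_scheme_def ADP_scheme_def by blast
qed

end
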